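(* Let $p : \mathbb{Z} \to [0,1]$ be a probability mass function satisfying the following conditions. (C1) The support $\mathrm{spt}(p) = \{k \in \mathbb{Z} : p(k) > 0\}$ equals $\{L, L+1, \dots, R\}$, where $L, R \in \mathbb{Z} \cup \{\pm\infty\}$, $L < R$. (C2) $\displaystyle \sup_{k \in \{L, \dots, R-1\}} \left| \frac{\Delta^+ p(k) \cdot \min\{P(k), 1 - P(k)\}}{p(k)\, p(k+1)} \right| < \infty$. (C3) $\mathbb{E}|Z| < \infty$, where $Z$ is a discrete random variable with probability mass function $p$. Assume moreover that $L > -\infty$. Let $X : \Omega \to \mathbb{R}$ be a random variable on a probability space $(\Omega, \mathcal{A}, \mathbb{P})$ with $\mathbb{P}(X \in \mathrm{spt}(p)) > 0$ and $$\mathbb{E} \left| \frac{\Delta^+ p(X)}{p(X)} \, X \cdot \mathbf{1}\{X \in \mathrm{spt}(p)\} \right| < \infty .$$ Let $\rho_{X|p}(k) = \mathbb{P}(X = k \mid X \in \mathrm{spt}(p))$, $k \in \mathbb{Z}$. Then $\rho_{X|p}(k) = p(k)$ for all $k \in \mathbb{Z}$ if, and only if, $$\rho_{X|p}(k) = \mathbb{E}\left[ - \frac{\Delta^+ p(X)}{p(X)} \, \mathbf{1}\{X \geq k\} \;\Big|\; X \in \mathrm{spt}(p) \right] \quad \text{for all } k \in \mathbb{Z},\ k \geq L .$$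
   Context: $\Delta^+ f(k) = f(k+1) - f(k)$ is the forward difference operator; since $p$ is defined on all of $\mathbb{Z}$ and vanishes off its support, $\Delta^+ p(R) = -p(R)$ if $R < \infty$. $P(k) = \sum_{\ell = L}^{k} p(\ell)$ is the distribution function of $p$. The notation $\{L, \dots, R\}$ means the set of all integers $k$ with $L \le k \le R$; in (C2) the supremum runs over all integers $k \geq L$ when $R = \infty$. For an event $A$ with $\mathbb{P}(A) > 0$, $\mathbb{E}[Y \mid A] = \mathbb{E}[Y \mathbf{1}_A]/\mathbb{P}(A)$; expressions such as $\Delta^+ p(X)/p(X)$ only matter on the event $\{X \in \mathrm{spt}(p)\}$. Empty sums are $0$. *)

theory Defs
  imports "HOL-Probability.Probability" "HOL-Library.Extended"
begin

(* frees the symbol for ereal *)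
no_notation Pinf (\<open>\<infinity>\<close>) and Minf (\<open>-\<infinity>\<close>)

definition fwd_diff :: "(int \<Rightarrow> real) \<Rightarrow> int \<Rightarrow> real" where
  "fwd_diff f k = f (k + 1) - f k"

definition int_range :: "int extended \<Rightarrow> int extended \<Rightarrow> int set" where
  "int_range L R = {k. L \<le> Fin k \<and> Fin k \<le> R}"

text \<open>The distribution function \<open>P(k) = p(L) + \<dots> + p(k)\<close>. An infinite sum, as \<open>L\<close> may be
  \<open>Minf\<close> here; it is a finite sum as soon as \<open>L\<close> is an integer.\<close>

definition dist_fun :: "int pmf \<Rightarrow> int extended \<Rightarrow> int \<Rightarrow> real" where
  "dist_fun p L k = (\<Sum>\<^sub>\<infinity>l\<in>int_range L (Fin k). pmf p l)"

definition cond_C1 :: "int pmf \<Rightarrow> int extended \<Rightarrow> int extended \<Rightarrow> bool" where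
  "cond_C1 p L R \<longleftrightarrow> L < R \<and> set_pmf p = int_range L R"

text \<open>The index set \<open>{L, \<dots>, R - 1}\<close> uses extended subtraction, with \<open>Pinf - 1 = Pinf\<close>.\<close>

definition cond_C2 :: "int pmf \<Rightarrow> int extended \<Rightarrow> int extended \<Rightarrow> bool" where
  "cond_C2 p L R \<longleftrightarrow>
     (SUP k\<in>int_range L (R - 1).
        ereal \<bar>fwd_diff (pmf p) k * min (dist_fun p L k) (1 - dist_fun p L k)
               / (pmf p k * pmf p (k + 1))\<bar>) < \<infinity>"

definition cond_C3 :: "int pmf \<Rightarrow> bool" where
  "cond_C3 p \<longleftrightarrow> integrable (measure_pmf p) (\<lambda>z. \<bar>real_of_int z\<bar>)"

text \<open>The support as a set of reals, for the events \<open>X \<in> spt(p)\<close> of a real random variable.\<close>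

definition spt :: "int pmf \<Rightarrow> real set" where
  "spt p = real_of_int ` set_pmf p"

text \<open>The quotient \<open>\<Delta>\<^sup>+p(x) / p(x)\<close> at a real argument. It is meaningful for \<open>x \<in> spt p\<close>, where
  the floor is exact, and is only to be used together with the indicator of that event.\<close>

definition diff_quot :: "int pmf \<Rightarrow> real \<Rightarrow> real" where
  "diff_quot p x = fwd_diff (pmf p) \<lfloor>x\<rfloor> / pmf p \<lfloor>x\<rfloor>"

text \<open>Conditioning on a single event \<open>A\<close> of positive probability, for \<open>Y 1\<^sub>A\<close> integrable.\<close>

definition cond_expectation :: "'a measure \<Rightarrow> ('a \<Rightarrow> real) \<Rightarrow> 'a set \<Rightarrow> real" where
  "cond_expectation M Y A = (\<integral>\<omega>. Y \<omega> * indicator A \<omega> \<partial>M) / measure M A"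

definition rho :: "'a measure \<Rightarrow> ('a \<Rightarrow> real) \<Rightarrow> int pmf \<Rightarrow> int \<Rightarrow> real" where
  "rho M X p k = \<P>(\<omega> in M. X \<omega> = real_of_int k \<bar> X \<omega> \<in> spt p)"

end

theory Submission
  imports Defs
begin

text \<open>Write \<open>t k\<close> for the conditional expectation and \<open>q\<close> for the quotient \<open>\<Delta>\<^sup>+p / p\<close>. Then
  \<open>t k - t (k + 1) = - q k * \<rho> k\<close>, and \<open>t\<close> vanishes at infinity by dominated convergence. If
  \<open>\<rho> = p\<close>, then \<open>t\<close> and \<open>p\<close> have the same increments on \<open>{L..}\<close> and the same limit, so they agree
  there. If \<open>\<rho> = t\<close> on \<open>{L..}\<close>, the increments give \<open>\<rho> (k + 1) / \<rho> k = p (k + 1) / p k\<close> on the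
  support, so \<open>\<rho>\<close> is a multiple of \<open>p\<close>; both have total mass 1.\<close>

section \<open>Measurability and the support\<close>

lemma measurable_diff_quot [measurable]: "diff_quot p \<in> borel_measurable borel"
proof -
  have "(\<lambda>k. fwd_diff (pmf p) k / pmf p k) \<circ> (floor :: real \<Rightarrow> int) \<in> borel_measurable borel"
    by (rule measurable_comp[OF measurable_real_floor]) simp
  then show ?thesis
    by (simp add: diff_quot_def[abs_def] comp_def)
qed

lemma sets_spt [measurable]: "spt p \<in> sets borel"
  by (rule sets.countable) (simp_all add: spt_def)

lemma spt_int_iff [simp]: "real_of_int k \<in> spt p \<longleftrightarrow> k \<in> set_pmf p"
  by (auto simp: spt_def)

text \<open>An integer left end and closure downwards to it are the form in which the support
  condition is used below; this treats finite and infinite \<open>R\<close> alike.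
  \<open>L < R\<close> excludes \<open>L = Pinf\<close>.\<close>

lemma cond_C1_support:
  assumes "cond_C1 p L R" "L > Minf"
  obtains l where "L = Fin l" "\<And>k. k \<in> set_pmf p \<Longrightarrow> l \<le> k"
    "\<And>j k. l \<le> j \<Longrightarrow> j \<le> k \<Longrightarrow> k \<in> set_pmf p \<Longrightarrow> j \<in> set_pmf p"
proof -
  from assms obtain l where l: "L = Fin l"
    by (cases L; cases R) (auto simp: cond_C1_def)
  have S: "set_pmf p = int_range (Fin l) R"
    using assms l by (simp add: cond_C1_def)
  show ?thesis
    by (rule that[OF l]; cases R) (auto simp: S int_range_def)
qed

lemma pmf_sums_1:
  fixes p :: "int pmf"
  assumes "\<And>k. k \<in> set_pmf p \<Longrightarrow> l \<le> k"
  shows "(\<lambda>n. pmf p (l + int n)) sums 1"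
proof -
  have "(\<lambda>n. measure (measure_pmf p) {l + int n}) sums measure (measure_pmf p) (\<Union>n. {l + int n})"
    by (rule measure_pmf.finite_measure_UNION) (auto simp: disjoint_family_on_def)
  moreover have "k \<in> (\<Union>n. {l + int n})" if "k \<in> set_pmf p" for k
    using assms[OF that] by (auto intro!: exI[of _ "nat (k - l)"])
  then have "measure (measure_pmf p) (\<Union>n. {l + int n}) = 1"
    by (intro measure_pmf.prob_eq_1[THEN iffD2]) (auto simp: AE_measure_pmf_iff)
  ultimately show ?thesis
    by (simp add: measure_pmf_single)
qed

lemma rho_eq_0:
  assumes "k \<notin> set_pmf p"
  shows "rho M X p k = 0"
proof -
  have "{\<omega> \<in> space M. X \<omega> = real_of_int k \<and> X \<omega> \<in> spt p} = {}"
    using assms by auto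
  then show ?thesis
    by (simp only: rho_def cond_prob_def measure_empty div_0)
qed

section \<open>The conditional law of \<open>X\<close>\<close>

context
  fixes p :: "int pmf" and M :: "'a measure" and X :: "'a \<Rightarrow> real"
  assumes M: "prob_space M"
    and X [measurable]: "X \<in> borel_measurable M"
    and pos: "\<P>(\<omega> in M. X \<omega> \<in> spt p) > 0"
begin

text \<open>The events \<open>X = l + n\<close> at support points partition the conditioning event,
  so dividing by its positive probability normalises the sum, whatever \<open>X\<close> does off the
  support.\<close>

lemma rho_sums_1:
  assumes lower: "\<And>k. k \<in> set_pmf p \<Longrightarrow> l \<le> k"
  shows "(\<lambda>n. rho M X p (l + int n)) sums 1"
proof -
  interpret prob_space M by (rule M)
  define A where "A n = {\<omega> \<in> space M. X \<omega> = real_of_int (l + int n) \<and> X \<omega> \<in> spt p}" for n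
  have "(\<lambda>n. prob (A n)) sums prob (\<Union>n. A n)"
  proof (rule finite_measure_UNION)
    show "range A \<subseteq> events"
      unfolding A_def by auto
    show "disjoint_family A"
      unfolding disjoint_family_on_def A_def by auto
  qed
  moreover have "(\<Union>n. A n) = {\<omega> \<in> space M. X \<omega> \<in> spt p}"
  proof -
    have "\<omega> \<in> (\<Union>n. A n)" if "\<omega> \<in> space M" "X \<omega> \<in> spt p" for \<omega>
    proof -
      obtain k where k: "X \<omega> = real_of_int k" "k \<in> set_pmf p"
        using \<open>X \<omega> \<in> spt p\<close> by (auto simp: spt_def)
      then have "\<omega> \<in> A (nat (k - l))"
        using that lower[of k] by (simp add: A_def)
      then show ?thesis by blast
    qed
    then show ?thesis
      by (auto simp: A_def)
  qed
  ultimately have "(\<lambda>n. prob (A n)) sums \<P>(\<omega> in M. X \<omega> \<in> spt p)"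
    by (simp only:)
  from sums_divide[OF this, of "\<P>(\<omega> in M. X \<omega> \<in> spt p)"]
  have "(\<lambda>n. prob (A n) / \<P>(\<omega> in M. X \<omega> \<in> spt p)) sums 1"
    using pos by simp
  then show ?thesis
    by (simp add: rho_def cond_prob_def A_def)
qed

text \<open>Nonzero support points are integers, so there the factor \<open>X\<close> only enlarges
  the integrand. At 0 that factor destroys all information; the constant
  \<open>\<bar>diff_quot p 0\<bar>\<close>, integrable under a probability measure, covers this
  point.\<close>

lemma integrable_diff_quot:
  assumes "integrable M (\<lambda>\<omega>. \<bar>diff_quot p (X \<omega>) * X \<omega> * indicator (spt p) (X \<omega>)\<bar>)"
  shows "integrable M (\<lambda>\<omega>. diff_quot p (X \<omega>) * indicator (spt p) (X \<omega>))"
proof -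
  interpret prob_space M by (rule M)
  let ?g = "\<lambda>\<omega>. \<bar>diff_quot p (X \<omega>) * X \<omega> * indicator (spt p) (X \<omega>)\<bar> + \<bar>diff_quot p 0\<bar>"
  have bound: "\<bar>diff_quot p x * indicator (spt p) x\<bar>
      \<le> \<bar>diff_quot p x * x * indicator (spt p) x\<bar> + \<bar>diff_quot p 0\<bar>" for x
  proof (cases "x \<in> spt p \<and> x \<noteq> 0")
    case True
    then obtain k where "x = real_of_int k" "k \<noteq> 0" by (auto simp: spt_def)
    then have "1 \<le> \<bar>x\<bar>" by linarith
    then have "\<bar>diff_quot p x\<bar> * 1 \<le> \<bar>diff_quot p x\<bar> * \<bar>x\<bar>"
      by (intro mult_left_mono) auto
    with True show ?thesis by (simp add: abs_mult)
  qed (auto simp: indicator_def)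
  show ?thesis
  proof (rule Bochner_Integration.integrable_bound)
    show "integrable M ?g" using assms by simp
    show "AE \<omega> in M. norm (diff_quot p (X \<omega>) * indicator (spt p) (X \<omega>)) \<le> norm (?g \<omega>)"
      by (rule AE_I2, unfold real_norm_def, rule order_trans[OF bound abs_ge_self])
  qed measurable
qed

section \<open>The tail expectation \<open>t\<close>: its increments and its limit\<close>

definition tail_exp :: "int \<Rightarrow> real" where
  "tail_exp k = cond_expectation M (\<lambda>\<omega>. - diff_quot p (X \<omega>) * indicator {real_of_int k..} (X \<omega>))
     {\<omega> \<in> space M. X \<omega> \<in> spt p}"

context
  assumes int: "integrable M (\<lambda>\<omega>. \<bar>diff_quot p (X \<omega>) * X \<omega> * indicator (spt p) (X \<omega>)\<bar>)"
begin

lemma tail_exp_altdef: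
  "tail_exp k = (\<integral>\<omega>. - (diff_quot p (X \<omega>) * indicator (spt p) (X \<omega>))
      * indicator {real_of_int k..} (X \<omega>) \<partial>M) / \<P>(\<omega> in M. X \<omega> \<in> spt p)"
  unfolding tail_exp_def cond_expectation_def
  by (intro arg_cong2[of _ _ _ _ "(/)"] Bochner_Integration.integral_cong)
     (auto simp: indicator_def)

text \<open>The two half-lines differ by the interval from \<open>k\<close> to \<open>k + 1\<close>,
  right end excluded, which can meet the support only in \<open>k\<close>. Off the support both
  sides are 0.\<close>

lemma tail_exp_diff:
  "tail_exp k - tail_exp (k + 1) = - (fwd_diff (pmf p) k / pmf p k) * rho M X p k"
proof -
  interpret prob_space M by (rule M)
  let ?f = "\<lambda>\<omega>. - (diff_quot p (X \<omega>) * indicator (spt p) (X \<omega>))"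
  let ?q = "fwd_diff (pmf p) k / pmf p k"
  let ?B = "{\<omega> \<in> space M. X \<omega> = real_of_int k \<and> X \<omega> \<in> spt p}"
  have f: "integrable M (\<lambda>\<omega>. ?f \<omega> * indicator {c..} (X \<omega>))" for c
    by (rule Bochner_Integration.integrable_bound[OF integrable_diff_quot[OF int]])
       (auto simp: indicator_def)
  have eq: "?f \<omega> * indicator {real_of_int k..} (X \<omega>) - ?f \<omega> * indicator {real_of_int (k + 1)..} (X \<omega>)
      = - ?q * indicator ?B \<omega>" if \<omega>: "\<omega> \<in> space M" for \<omega>
  proof (cases "X \<omega> \<in> spt p")
    case True
    then obtain j where j: "X \<omega> = real_of_int j" "j \<in> set_pmf p" by (auto simp: spt_def)
    consider "j < k" | "j = k" | "j \<ge> k + 1" by linarith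
    then show ?thesis
      by cases (use j \<omega> in \<open>auto simp: indicator_def diff_quot_def\<close>)
  qed (auto simp: indicator_def)
  have "(\<integral>\<omega>. ?f \<omega> * indicator {real_of_int k..} (X \<omega>) \<partial>M)
      - (\<integral>\<omega>. ?f \<omega> * indicator {real_of_int (k + 1)..} (X \<omega>) \<partial>M)
      = (\<integral>\<omega>. - ?q * indicator ?B \<omega> \<partial>M)"
    unfolding Bochner_Integration.integral_diff[OF f f, symmetric]
    by (rule Bochner_Integration.integral_cong[OF refl eq])
  also have "\<dots> = - ?q * prob ?B"
    by simp
  finally show ?thesis
    by (simp add: tail_exp_altdef rho_def cond_prob_def diff_divide_distrib[symmetric])
qed

lemma tail_exp_tendsto_0: "(\<lambda>n. tail_exp (k + int n)) \<longlonglongrightarrow> 0"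
proof -
  interpret prob_space M by (rule M)
  let ?f = "\<lambda>\<omega>. - (diff_quot p (X \<omega>) * indicator (spt p) (X \<omega>))"
  have "(\<lambda>n. \<integral>\<omega>. ?f \<omega> * indicator {real_of_int (k + int n)..} (X \<omega>) \<partial>M) \<longlonglongrightarrow> (\<integral>\<omega>. 0 \<partial>M)"
  proof (rule integral_dominated_convergence)
    show "integrable M (\<lambda>\<omega>. norm (?f \<omega>))"
      using integrable_diff_quot[OF int] by simp
    show "AE \<omega> in M. (\<lambda>n. ?f \<omega> * indicator {real_of_int (k + int n)..} (X \<omega>)) \<longlonglongrightarrow> 0"
    proof (rule AE_I2, rule tendsto_eventually)
      fix \<omega>
      \<comment> \<open>From \<open>n = N\<close> on, \<open>k + n\<close> exceeds
        \<open>X \<omega>\<close> and the indicator is 0.\<close>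
      obtain N where N: "X \<omega> - real_of_int k < real N"
        using reals_Archimedean2 by blast
      show "\<forall>\<^sub>F n in sequentially. ?f \<omega> * indicator {real_of_int (k + int n)..} (X \<omega>) = 0"
        using eventually_ge_at_top[of N]
      proof eventually_elim
        case (elim n)
        then have "real N \<le> real n" by simp
        with N show ?case by (auto simp: indicator_def)
      qed
    qed
  qed (auto simp: indicator_def)
  then show ?thesis
    unfolding tail_exp_altdef by (intro tendsto_divide_zero) simp
qed

section \<open>The two implications\<close>

lemma tail_exp_eq_pmf:
  assumes lower: "\<And>k. k \<in> set_pmf p \<Longrightarrow> l \<le> k"
    and conv: "\<And>j k. l \<le> j \<Longrightarrow> j \<le> k \<Longrightarrow> k \<in> set_pmf p \<Longrightarrow> j \<in> set_pmf p"
    and rho: "\<And>k. rho M X p k = pmf p k" and "l \<le> k"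
  shows "tail_exp k = pmf p k"
proof -
  \<comment> \<open>\<open>d\<close> starts at \<open>l\<close>: further left
    \<open>tail_exp\<close> keeps the value \<open>pmf p l\<close>, while \<open>pmf p\<close> is
    0.\<close>
  define d where "d n = tail_exp (l + int n) - pmf p (l + int n)" for n
  have "d (Suc n) = d n" for n
  proof -
    let ?k = "l + int n"
    have "tail_exp ?k - tail_exp (?k + 1) = pmf p ?k - pmf p (?k + 1)"
    proof (cases "?k \<in> set_pmf p")
      case True
      then have "pmf p ?k \<noteq> 0" by (simp add: set_pmf_iff)
      then show ?thesis
        by (simp add: tail_exp_diff rho fwd_diff_def)
    next
      case False
      \<comment> \<open>A return to the support after a gap would break the identity:
        \<open>tail_exp\<close> is constant across \<open>?k\<close>, but \<open>pmf p\<close> would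
        jump.\<close>
      then have "?k + 1 \<notin> set_pmf p" using conv[of ?k "?k + 1"] by auto
      with False show ?thesis
        by (simp add: tail_exp_diff rho set_pmf_iff)
    qed
    then show ?thesis
      by (simp add: d_def add.assoc[symmetric] add.commute[of 1])
  qed
  then have const: "d n = d 0" for n
    by (induction n) simp_all
  have "(\<lambda>n. d n) \<longlonglongrightarrow> 0 - 0"
    unfolding d_def
    by (intro tendsto_diff tail_exp_tendsto_0 summable_LIMSEQ_zero sums_summable[OF pmf_sums_1] lower)
  moreover have "(\<lambda>n. d n) \<longlonglongrightarrow> d 0"
    by (intro tendsto_eventually always_eventually allI const)
  ultimately have "d 0 = 0"
    using LIMSEQ_unique by fastforce
  then have "d (nat (k - l)) = 0"
    using const[of "nat (k - l)"] by (rule trans[rotated])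
  with \<open>l \<le> k\<close> show ?thesis by (simp add: d_def)
qed

lemma rho_eq_pmf:
  assumes lower: "\<And>k. k \<in> set_pmf p \<Longrightarrow> l \<le> k"
    and conv: "\<And>j k. l \<le> j \<Longrightarrow> j \<le> k \<Longrightarrow> k \<in> set_pmf p \<Longrightarrow> j \<in> set_pmf p"
    and rho: "\<And>k. l \<le> k \<Longrightarrow> rho M X p k = tail_exp k"
  shows "rho M X p k = pmf p k"
proof -
  \<comment> \<open>The candidate factor of proportionality, read off at the left end. The division
    is proper because the support is nonempty and closed downwards to \<open>l\<close>.\<close>
  define a where "a = rho M X p l / pmf p l"
  have "set_pmf p \<noteq> {}" by (rule set_pmf_not_empty)
  then have "l \<in> set_pmf p" using lower conv by blast
  then have l: "pmf p l \<noteq> 0" by (simp add: set_pmf_iff)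
  have mult: "rho M X p (l + int n) = a * pmf p (l + int n)" for n
  proof (induction n)
    case 0
    then show ?case using l by (simp add: a_def)
  next
    case (Suc n)
    let ?k = "l + int n"
    have "rho M X p (?k + 1) = a * pmf p (?k + 1)"
    proof (cases "?k \<in> set_pmf p")
      case True
      then have "pmf p ?k \<noteq> 0" by (simp add: set_pmf_iff)
      \<comment> \<open>The hypothesis at \<open>?k\<close> and \<open>?k + 1\<close> turns the
        increment formula into a recursion for \<open>rho\<close>. It never divides by
        \<open>rho\<close>, which may still be 0 here.\<close>
      moreover have "rho M X p (?k + 1) = rho M X p ?k + fwd_diff (pmf p) ?k / pmf p ?k * rho M X p ?k"
        using tail_exp_diff[of ?k] rho[of ?k] rho[of "?k + 1"] by simp
      ultimately show ?thesis
        by (simp add: Suc fwd_diff_def field_simps)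
    next
      case False
      then have "?k + 1 \<notin> set_pmf p" using conv[of ?k "?k + 1"] by auto
      then show ?thesis
        by (simp add: rho_eq_0 set_pmf_iff)
    qed
    then show ?case by (simp add: add.assoc[symmetric] add.commute[of 1])
  qed
  have "(\<lambda>n. a * pmf p (l + int n)) sums (a * 1)"
    by (intro sums_mult pmf_sums_1 lower)
  moreover have "(\<lambda>n. a * pmf p (l + int n)) sums 1"
    using rho_sums_1[OF lower] by (simp add: mult)
  \<comment> \<open>Both laws have mass 1 on the integers from \<open>l\<close> on, which fixes the
    factor.\<close>
  ultimately have "a = 1" using sums_unique2 by fastforce
  show ?thesis
  proof (cases "k \<in> set_pmf p")
    case True
    then show ?thesis using mult[of "nat (k - l)"] lower[OF True] \<open>a = 1\<close> by simp
  qed (simp add: rho_eq_0 set_pmf_iff)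
qed

end

end

theorem theorem3p1:
  fixes p :: "int pmf" and L R :: "int extended"
    and M :: "'a measure" and X :: "'a \<Rightarrow> real"
  assumes C1: "cond_C1 p L R"
    and C2: "cond_C2 p L R"
    and C3: "cond_C3 p"
    and L: "L > Minf"
    and M: "prob_space M"
    and X: "X \<in> borel_measurable M"
    and pos: "\<P>(\<omega> in M. X \<omega> \<in> spt p) > 0"
    and int: "integrable M (\<lambda>\<omega>. \<bar>diff_quot p (X \<omega>) * X \<omega> * indicator (spt p) (X \<omega>)\<bar>)"
  shows "(\<forall>k. rho M X p k = pmf p k) \<longleftrightarrow>
    (\<forall>k. Fin k \<ge> L \<longrightarrow>
       rho M X p k =
         cond_expectation M (\<lambda>\<omega>. - diff_quot p (X \<omega>) * indicator {real_of_int k..} (X \<omega>))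
           {\<omega> \<in> space M. X \<omega> \<in> spt p})"
  using C1 L
proof (rule cond_C1_support)
  fix l
  assume l: "L = Fin l" "\<And>k. k \<in> set_pmf p \<Longrightarrow> l \<le> k"
    "\<And>j k. l \<le> j \<Longrightarrow> j \<le> k \<Longrightarrow> k \<in> set_pmf p \<Longrightarrow> j \<in> set_pmf p"
  have "(\<forall>k. rho M X p k = pmf p k) \<longleftrightarrow> (\<forall>k\<ge>l. rho M X p k = tail_exp p M X k)"
  proof (intro iffI allI impI)
    fix k
    assume rho: "\<forall>k. rho M X p k = pmf p k" and "l \<le> k"
    then have "tail_exp p M X k = pmf p k"
      by (intro tail_exp_eq_pmf[OF M X pos int l(2,3)]) blast+
    with rho show "rho M X p k = tail_exp p M X k" by simp
  next
    fix k
    assume "\<forall>k\<ge>l. rho M X p k = tail_exp p M X k"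
    then show "rho M X p k = pmf p k"
      by (intro rho_eq_pmf[OF M X pos int l(2,3)]) blast+
  qed
  then show ?thesis
    by (simp add: l(1) tail_exp_def[OF M X pos])
qed

end
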